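(* The condition "$\mathrm{Tr}(U^*WV)+\|\bar U^*W\bar V\|_*>0$ for all nonzero $W\in\mathcal{N}(\mathcal{A})$" is not necessary for a matrix $X=U\Sigma V^*$ to be the unique solution of the nuclear norm minimization problem. Specifically, let $\mathbb{F}=\mathbb{R}$ or $\mathbb{F}=\mathbb{C}$, let $$X=\begin{bmatrix}-1&0\\0&0\end{bmatrix},\quad Q=\begin{bmatrix}1&1\\1&1\end{bmatrix},\quad U=\begin{bmatrix}1\\0\end{bmatrix},\quad V=\begin{bmatrix}-1\\0\end{bmatrix},\quad \bar U=\bar V=\begin{bmatrix}0\\1\end{bmatrix},$$ so that $X=U\cdot 1\cdot V^*$ is a singular value decomposition of $X$ and $[U\ \bar U]$, $[V\ \bar V]$ are unitary, and let $\mathcal{A}:\mathbb{F}^{2\times 2}\to\mathbb{F}^m$ be a linear map with null space $\mathcal{N}(\mathcal{A})=\{tQ: t\in\mathbb{F}\}$. Then $$-|\mathrm{Tr}(U^*QV)|+\|\bar U^*Q\bar V\|_*=\mathrm{Tr}(U^*QV)+\|\bar U^*Q\bar V\|_*=0,$$ so the condition fails for $W=Q$, but $\|X+tQ\|_*>1=\|X\|_*$ for every $t\in\mathbb{F}$ with $t\neq 0$, so $X$ is the unique solution of: minimize $\|Y\|_*$ over $Y\in\mathbb{F}^{2\times2}$ subject to $\mathcal{A}(Y)=\mathcal{A}(X)$.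
   Context: $\|\cdot\|_*$ is the nuclear norm (sum of singular values), $\mathrm{Tr}$ the trace, and $^*$ the conjugate transpose. In the displayed condition, $X=U\Sigma V^*$ is the compact singular value decomposition of the rank-$r$ matrix $X$ (with $\Sigma\in\mathbb{R}^{r\times r}$), and $\bar U,\bar V$ are chosen such that $[U\ \bar U]$ and $[V\ \bar V]$ are unitary. *)

theory Defs
  imports "Jordan_Normal_Form.Schur_Decomposition" "Jordan_Normal_Form.Char_Poly"
begin

text \<open>The scalar field is a set \<open>F\<close> of complex numbers, \<open>\<real>\<close> or \<open>UNIV\<close>. Matrices and vectors
  over \<open>F\<close> are complex ones with all entries in \<open>F\<close>. For real entries the conjugate transpose
  is the transpose, \<open>unitary\<close> means orthogonal, and the singular values are the usual ones.\<close>

definition mats_over :: "complex set \<Rightarrow> nat \<Rightarrow> nat \<Rightarrow> complex mat set" where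
  "mats_over F p q = {M \<in> carrier_mat p q. elements_mat M \<subseteq> F}"

definition vecs_over :: "complex set \<Rightarrow> nat \<Rightarrow> complex vec set" where
  "vecs_over F m = {v \<in> carrier_vec m. vec_set v \<subseteq> F}"

definition linear_over ::
  "complex set \<Rightarrow> nat \<Rightarrow> nat \<Rightarrow> nat \<Rightarrow> (complex mat \<Rightarrow> complex vec) \<Rightarrow> bool" where
  "linear_over F p q m \<A> \<longleftrightarrow>
     (\<forall>Y \<in> mats_over F p q. \<A> Y \<in> vecs_over F m) \<and>
     (\<forall>Y \<in> mats_over F p q. \<forall>Z \<in> mats_over F p q. \<A> (Y + Z) = \<A> Y + \<A> Z) \<and>
     (\<forall>c \<in> F. \<forall>Y \<in> mats_over F p q. \<A> (c \<cdot>\<^sub>m Y) = c \<cdot>\<^sub>v \<A> Y)"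

definition null_space ::
  "complex set \<Rightarrow> nat \<Rightarrow> nat \<Rightarrow> nat \<Rightarrow> (complex mat \<Rightarrow> complex vec) \<Rightarrow> complex mat set" where
  "null_space F p q m \<A> = {W \<in> mats_over F p q. \<A> W = 0\<^sub>v m}"

definition mat_trace :: "complex mat \<Rightarrow> complex" where
  "mat_trace M = sum_list (diag_mat M)"

text \<open>Square roots of the eigenvalues of \<open>M\<^sup>*M\<close> with algebraic multiplicity. These eigenvalues are
  real and nonnegative, so \<open>Re\<close> loses nothing. A \<open>p \<times> q\<close> matrix gets \<open>q\<close> singular values here,
  which differs from other conventions only in the number of zeros.\<close>

definition singular_values :: "complex mat \<Rightarrow> real multiset" where
  "singular_values M = image_mset (\<lambda>z. sqrt (Re z)) (proots (char_poly (mat_adjoint M * M)))"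

definition nuclear_norm :: "complex mat \<Rightarrow> real" where
  "nuclear_norm M = (\<Sum>\<sigma> \<in># singular_values M. \<sigma>)"

definition unitary_mat :: "nat \<Rightarrow> complex mat \<Rightarrow> bool" where
  "unitary_mat n P \<longleftrightarrow>
     P \<in> carrier_mat n n \<and> mat_adjoint P * P = 1\<^sub>m n \<and> P * mat_adjoint P = 1\<^sub>m n"

definition join_cols :: "complex mat \<Rightarrow> complex mat \<Rightarrow> complex mat" where
  "join_cols A B = mat_of_cols (dim_row A) (cols A @ cols B)"

definition compact_svd ::
  "complex set \<Rightarrow> nat \<Rightarrow> nat \<Rightarrow> nat \<Rightarrow> complex mat \<Rightarrow> complex mat \<Rightarrow> real mat \<Rightarrow> complex mat \<Rightarrow> bool"
  where
  "compact_svd F p q r X U S V \<longleftrightarrow>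
     X \<in> mats_over F p q \<and> U \<in> mats_over F p r \<and> V \<in> mats_over F q r \<and>
     mat_adjoint U * U = 1\<^sub>m r \<and> mat_adjoint V * V = 1\<^sub>m r \<and>
     S \<in> carrier_mat r r \<and> diagonal_mat S \<and> (\<forall>i<r. 0 < S $$ (i, i)) \<and>
     (\<forall>i j. i \<le> j \<and> j < r \<longrightarrow> S $$ (j, j) \<le> S $$ (i, i)) \<and>
     X = U * map_mat complex_of_real S * mat_adjoint V"

definition unitary_completion ::
  "complex set \<Rightarrow> nat \<Rightarrow> nat \<Rightarrow> complex mat \<Rightarrow> complex mat \<Rightarrow> bool" where
  "unitary_completion F p r U Ub \<longleftrightarrow>
     U \<in> mats_over F p r \<and> Ub \<in> mats_over F p (p - r) \<and> unitary_mat p (join_cols U Ub)"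

text \<open>For complex \<open>F\<close> the trace need not be real; the inequality is read with its real part.
  This is weaker than asking that the complex number be real and positive, so non-necessity
  of it is the stronger claim.\<close>

definition null_space_condition ::
  "complex mat set \<Rightarrow> complex mat \<Rightarrow> complex mat \<Rightarrow> complex mat \<Rightarrow> complex mat \<Rightarrow> bool" where
  "null_space_condition N U V Ub Vb \<longleftrightarrow>
     (\<forall>W \<in> N. W \<noteq> 0\<^sub>m (dim_row W) (dim_col W) \<longrightarrow>
        Re (mat_trace (mat_adjoint U * W * V)) + nuclear_norm (mat_adjoint Ub * W * Vb) > 0)"

definition nnm_solutions ::
  "complex set \<Rightarrow> nat \<Rightarrow> nat \<Rightarrow> (complex mat \<Rightarrow> complex vec) \<Rightarrow> complex vec \<Rightarrow> complex mat set"
  where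
  "nnm_solutions F p q \<A> b =
     {Y. is_arg_min nuclear_norm (\<lambda>Z. Z \<in> mats_over F p q \<and> \<A> Z = b) Y}"

end

theory Submission
  imports Defs
begin

text \<open>The condition compares the one-sided directional derivative of the nuclear norm at \<open>X\<close> with
  zero. A vanishing derivative leaves uniqueness to the second order terms, and the example is
  built so that the derivative along \<open>Q\<close> vanishes while these terms still force growth.

  For a \<open>2 \<times> 2\<close> matrix \<open>M\<close> the square of the nuclear norm is the sum of the squared moduli of
  the entries plus \<open>2 * cmod (det M)\<close> (\<open>nuclear_norm_2\<close>). For \<open>M = X + t Q\<close> this equals
  \<open>\<bar>t - 1\<bar>\<^sup>2 + 3 * \<bar>t\<bar>\<^sup>2 + 2 * \<bar>t\<bar>\<close>, which is at least \<open>1 + 4 * \<bar>t\<bar>\<^sup>2\<close> because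
  \<open>\<bar>t - 1\<bar> \<ge> \<bar>1 - \<bar>t\<bar>\<bar>\<close> (\<open>nuclear_norm_corner_perturbation\<close>). The
  feasible matrices are exactly the \<open>X + t Q\<close>, so \<open>X\<close> is the unique solution
  (\<open>nnm_solutions_singletonI\<close>), although \<open>W = Q\<close> gives \<open>-1 + 1 = 0\<close> in the condition. To refute
  necessity one also needs some map with the null space spanned by \<open>Q\<close>; \<open>entry_differences\<close> is
  one over both fields.\<close>

section \<open>Entries of small matrices\<close>

lemma mats_over_iff:
  "M \<in> mats_over F p q \<longleftrightarrow> M \<in> carrier_mat p q \<and> (\<forall>i<p. \<forall>j<q. M $$ (i, j) \<in> F)"
  unfolding mats_over_def by auto

lemma vecs_over_iff: "v \<in> vecs_over F m \<longleftrightarrow> v \<in> carrier_vec m \<and> (\<forall>i<m. v $ i \<in> F)"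
  unfolding vecs_over_def vec_set_def by auto

lemma dim_mat_adjoint [simp]:
  "dim_row (mat_adjoint A) = dim_col A" "dim_col (mat_adjoint A) = dim_row A"
  unfolding mat_adjoint_def by auto

lemma mat_adjoint_carrier: "A \<in> carrier_mat p q \<Longrightarrow> mat_adjoint A \<in> carrier_mat q p"
  by (auto intro: carrier_matI)

lemma index_mat_adjoint [simp]:
  "i < dim_col A \<Longrightarrow> j < dim_row A \<Longrightarrow> mat_adjoint A $$ (i, j) = conjugate (A $$ (j, i))"
  unfolding mat_adjoint_def by (simp add: mat_of_rows_index)

lemma all_less_two: "(\<forall>i<2::nat. P i) \<longleftrightarrow> P 0 \<and> P 1"
  by (auto simp: numeral_2_eq_2 less_Suc_eq)

lemma index_mult_1:
  fixes A B :: "complex mat"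
  assumes "dim_col A = 1" "dim_row B = 1" "i < dim_row A" "j < dim_col B"
  shows "(A * B) $$ (i, j) = A $$ (i, 0) * B $$ (0, j)"
  using assms by (simp add: scalar_prod_def)

lemma index_mult_2:
  fixes A B :: "complex mat"
  assumes "dim_col A = 2" "dim_row B = 2" "i < dim_row A" "j < dim_col B"
  shows "(A * B) $$ (i, j) = A $$ (i, 0) * B $$ (0, j) + A $$ (i, 1) * B $$ (1, j)"
  using assms by (simp add: scalar_prod_def numeral_2_eq_2)

lemma mat_trace_1: "M \<in> carrier_mat 1 1 \<Longrightarrow> mat_trace M = M $$ (0, 0)"
  by (simp add: mat_trace_def diag_mat_def)

lemma det_2:
  fixes A :: "'a :: comm_ring_1 mat"
  assumes "A \<in> carrier_mat 2 2"
  shows "det A = A $$ (0, 0) * A $$ (1, 1) - A $$ (0, 1) * A $$ (1, 0)"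
proof -
  have minor: "det (mat_delete A 0 j) = A $$ (1, if j = 0 then 1 else 0)" if "j < 2" for j
  proof -
    have "mat_delete A 0 j \<in> carrier_mat 1 1"
      using mat_delete_carrier[OF assms, of 0 j] by simp
    then show ?thesis
      using assms that by (auto simp: det_single mat_delete_def)
  qed
  have "det A = (\<Sum>j<2. A $$ (0, j) * cofactor A 0 j)"
    by (rule laplace_expansion_row[OF assms]) simp
  then show ?thesis
    by (simp add: numeral_2_eq_2 cofactor_def minor)
qed

lemma char_poly_1:
  fixes A :: "complex mat"
  assumes "A \<in> carrier_mat 1 1"
  shows "char_poly A = [:- (A $$ (0, 0)), 1:]"
proof -
  have "char_poly A = char_poly_matrix A $$ (0, 0)"
    unfolding char_poly_def by (rule det_single) (use assms in simp)
  then show ?thesis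
    using assms by (simp add: char_poly_matrix_def)
qed

lemma char_poly_2:
  fixes A :: "complex mat"
  assumes "A \<in> carrier_mat 2 2"
  shows "char_poly A =
    [:A $$ (0, 0) * A $$ (1, 1) - A $$ (0, 1) * A $$ (1, 0), - (A $$ (0, 0) + A $$ (1, 1)), 1:]"
  unfolding char_poly_def using assms
  by (subst det_2) (auto simp: char_poly_matrix_def algebra_simps)

section \<open>The nuclear norm in dimensions one and two\<close>

lemma nuclear_norm_1:
  assumes "M \<in> carrier_mat 1 1"
  shows "nuclear_norm M = cmod (M $$ (0, 0))"
proof -
  have "mat_adjoint M * M \<in> carrier_mat 1 1"
    using assms mat_adjoint_carrier by auto
  moreover have "(mat_adjoint M * M) $$ (0, 0) = complex_of_real ((cmod (M $$ (0, 0)))\<^sup>2)"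
    using assms by (subst index_mult_1) (auto simp: complex_norm_square mult.commute simp del: of_real_power)
  ultimately have "char_poly (mat_adjoint M * M) = [:- complex_of_real ((cmod (M $$ (0, 0)))\<^sup>2), 1:]"
    by (simp add: char_poly_1)
  then show ?thesis
    by (simp add: nuclear_norm_def singular_values_def flip: of_real_power)
qed

text \<open>If \<open>T\<close> is the sum of the squared singular values and \<open>d\<close> is their product, then
  the square of their sum is \<open>T + 2 * d\<close>. Here \<open>T\<close> is the trace of \<open>M\<^sup>*M\<close> and \<open>d\<^sup>2\<close> its
  determinant. The two singular values can be written down as
  \<open>(sqrt (T + 2 * d) \<plusminus> sqrt (T - 2 * d)) / 2\<close>, and their squares are the roots of the
  characteristic polynomial.\<close>

lemma nuclear_norm_2:
  assumes M: "M \<in> carrier_mat 2 2"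
  shows "nuclear_norm M = sqrt (
    (cmod (M $$ (0, 0)))\<^sup>2 + (cmod (M $$ (0, 1)))\<^sup>2 + (cmod (M $$ (1, 0)))\<^sup>2 + (cmod (M $$ (1, 1)))\<^sup>2
    + 2 * cmod (M $$ (0, 0) * M $$ (1, 1) - M $$ (0, 1) * M $$ (1, 0)))"
proof -
  define a b c e where "a = M $$ (0, 0)" and "b = M $$ (0, 1)" and "c = M $$ (1, 0)" and "e = M $$ (1, 1)"
  define T d where "T = (cmod a)\<^sup>2 + (cmod b)\<^sup>2 + (cmod c)\<^sup>2 + (cmod e)\<^sup>2" and "d = cmod (a * e - b * c)"
  define s1 s2 where "s1 = (sqrt (T + 2 * d) + sqrt (T - 2 * d)) / 2"
    and "s2 = (sqrt (T + 2 * d) - sqrt (T - 2 * d)) / 2"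
  have "d \<ge> 0" by (simp add: d_def)
  have "d \<le> cmod a * cmod e + cmod b * cmod c"
    unfolding d_def by (metis norm_mult norm_triangle_ineq4)
  moreover have "2 * (cmod a * cmod e) \<le> (cmod a)\<^sup>2 + (cmod e)\<^sup>2"
    using sum_squares_bound[of "cmod a" "cmod e"] by simp
  moreover have "2 * (cmod b * cmod c) \<le> (cmod b)\<^sup>2 + (cmod c)\<^sup>2"
    using sum_squares_bound[of "cmod b" "cmod c"] by simp
  ultimately have "T \<ge> 2 * d"
    unfolding T_def by linarith
  have "s1 \<ge> 0"
    unfolding s1_def using \<open>d \<ge> 0\<close> \<open>T \<ge> 2 * d\<close> by simp
  have "s2 \<ge> 0"
    unfolding s2_def using \<open>d \<ge> 0\<close> by simp
  have sq: "(sqrt (T + 2 * d))\<^sup>2 = T + 2 * d" "(sqrt (T - 2 * d))\<^sup>2 = T - 2 * d"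
    using \<open>d \<ge> 0\<close> \<open>T \<ge> 2 * d\<close> by simp_all
  have sum: "s1\<^sup>2 + s2\<^sup>2 = T"
    using sq unfolding s1_def s2_def by (simp add: power2_sum power2_diff power_divide field_simps)
  have prod: "s1 * s2 = d"
    using sq unfolding s1_def s2_def by (simp add: field_simps power2_eq_square)
  let ?B = "mat_adjoint M * M"
  have B: "?B \<in> carrier_mat 2 2"
    using M mat_adjoint_carrier by auto
  have tr: "?B $$ (0, 0) + ?B $$ (1, 1) = complex_of_real T"
    using M by (simp add: index_mult_2 T_def a_def b_def c_def e_def complex_norm_square
        mult.commute del: index_mult_mat(1) of_real_power)
  have "?B $$ (0, 0) * ?B $$ (1, 1) - ?B $$ (0, 1) * ?B $$ (1, 0)
      = (a * e - b * c) * cnj (a * e - b * c)"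
    using M by (simp add: index_mult_2 a_def b_def c_def e_def algebra_simps del: index_mult_mat(1))
  also have "\<dots> = complex_of_real (d\<^sup>2)"
    by (simp only: d_def complex_norm_square)
  finally have det: "?B $$ (0, 0) * ?B $$ (1, 1) - ?B $$ (0, 1) * ?B $$ (1, 0)
      = complex_of_real (d\<^sup>2)" .
  have "char_poly ?B = [:complex_of_real (d\<^sup>2), - complex_of_real T, 1:]"
    unfolding char_poly_2[OF B] tr det ..
  also have "\<dots> = [:- complex_of_real (s1\<^sup>2), 1:] * [:- complex_of_real (s2\<^sup>2), 1:]"
    unfolding sum[symmetric] prod[symmetric] by (simp add: power_mult_distrib)
  finally have "proots (char_poly ?B) = {#complex_of_real (s1\<^sup>2), complex_of_real (s2\<^sup>2)#}"
    by (simp add: proots_mult del: mult_pCons_left mult_pCons_right of_real_power)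
  then have "nuclear_norm M = s1 + s2"
    using \<open>s1 \<ge> 0\<close> \<open>s2 \<ge> 0\<close>
    by (simp add: nuclear_norm_def singular_values_def del: of_real_power)
  also have "\<dots> = sqrt (T + 2 * d)"
    by (simp add: s1_def s2_def field_simps)
  finally show ?thesis
    by (simp add: T_def d_def a_def b_def c_def e_def)
qed

text \<open>The determinant of the perturbed matrix is \<open>-t\<close>. It contributes \<open>2 * cmod t\<close> to the
  square of the norm, which offsets the largest first order loss \<open>2 * cmod t\<close> that moving the
  corner entry from \<open>-1\<close> to \<open>t - 1\<close> can cause; the quadratic terms then decide.\<close>

lemma nuclear_norm_corner_perturbation:
  fixes t :: complex
  assumes M: "M \<in> carrier_mat 2 2"
    and entries: "M $$ (0, 0) = t - 1" "M $$ (0, 1) = t" "M $$ (1, 0) = t" "M $$ (1, 1) = t"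
    and "t \<noteq> 0"
  shows "nuclear_norm M > 1"
proof -
  have norm: "nuclear_norm M = sqrt ((cmod (t - 1))\<^sup>2 + 3 * (cmod t)\<^sup>2 + 2 * cmod t)"
    unfolding nuclear_norm_2[OF M] entries by (simp add: algebra_simps)
  have "(1 - cmod t)\<^sup>2 \<le> (cmod (t - 1))\<^sup>2"
    using norm_triangle_ineq3[of 1 t] by (metis abs_le_square_iff abs_norm_cancel norm_minus_commute norm_one)
  moreover have "(cmod t)\<^sup>2 > 0"
    using \<open>t \<noteq> 0\<close> by simp
  ultimately have "(cmod (t - 1))\<^sup>2 + 3 * (cmod t)\<^sup>2 + 2 * cmod t > 1"
    by (simp only: power2_diff power_one mult_1_right)
  then show ?thesis
    unfolding norm by simp
qed

section \<open>Unique minimisers and the null space\<close>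

text \<open>The feasible set is \<open>X + N\<close>, where \<open>N\<close> is the null space, so a unique minimum at \<open>X\<close> is a
  strict increase along every nonzero element of \<open>N\<close>.\<close>

lemma nnm_solutions_singletonI:
  assumes F: "F = \<real> \<or> F = UNIV"
    and lin: "linear_over F p q m \<A>"
    and X: "X \<in> mats_over F p q"
    and less: "\<And>W. W \<in> null_space F p q m \<A> \<Longrightarrow> W \<noteq> 0\<^sub>m p q \<Longrightarrow> nuclear_norm X < nuclear_norm (X + W)"
  shows "nnm_solutions F p q \<A> (\<A> X) = {X}"
proof -
  have strict: "nuclear_norm X < nuclear_norm Y"
    if Y: "Y \<in> mats_over F p q" "\<A> Y = \<A> X" "Y \<noteq> X" for Y
  proof -
    have cX: "X \<in> carrier_mat p q" and cY: "Y \<in> carrier_mat p q"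
      using X Y by (auto simp: mats_over_def)
    have m1: "-1 \<in> F"
      using F by auto
    have nX: "(-1) \<cdot>\<^sub>m X \<in> mats_over F p q"
      using F X by (auto simp: mats_over_iff)
    define W where "W = Y + (-1) \<cdot>\<^sub>m X"
    have W: "W \<in> mats_over F p q"
      using F X Y by (auto simp: W_def mats_over_iff)
    have "\<A> X \<in> carrier_vec m"
      using lin X by (auto simp: linear_over_def vecs_over_def)
    moreover have "\<A> W = \<A> Y + (-1) \<cdot>\<^sub>v \<A> X"
      using lin Y nX X m1 by (simp add: linear_over_def W_def)
    ultimately have "\<A> W = 0\<^sub>v m"
      using Y by auto
    then have "W \<in> null_space F p q m \<A>"
      using W by (simp add: null_space_def)
    moreover have XW: "X + W = Y"
      using cX cY by (intro eq_matI) (auto simp: W_def)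
    moreover have "W \<noteq> 0\<^sub>m p q"
      using XW cX \<open>Y \<noteq> X\<close> by auto
    ultimately show ?thesis
      using less by metis
  qed
  show ?thesis
  proof (intro equalityI subsetI)
    fix Y assume "Y \<in> nnm_solutions F p q \<A> (\<A> X)"
    then show "Y \<in> {X}"
      using strict[of Y] X by (auto simp: nnm_solutions_def is_arg_min_def)
  next
    fix Y assume "Y \<in> {X}"
    then show "Y \<in> nnm_solutions F p q \<A> (\<A> X)"
      using strict X by (fastforce simp: nnm_solutions_def is_arg_min_def)
  qed
qed

section \<open>A map with the prescribed null space\<close>

text \<open>A matrix is a multiple of the all-ones matrix iff its entries agree, which three
  differences of entries detect.\<close>

definition entry_differences :: "complex mat \<Rightarrow> complex vec" where
  "entry_differences Y =
     vec_of_list [Y $$ (0, 0) - Y $$ (1, 1), Y $$ (0, 1) - Y $$ (1, 1), Y $$ (1, 0) - Y $$ (1, 1)]"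

lemma entry_differences_vec [simp]:
  "dim_vec (entry_differences Y) = 3"
  "entry_differences Y $ 0 = Y $$ (0, 0) - Y $$ (1, 1)"
  "entry_differences Y $ Suc 0 = Y $$ (0, 1) - Y $$ (1, 1)"
  "entry_differences Y $ 2 = Y $$ (1, 0) - Y $$ (1, 1)"
  by (simp_all add: entry_differences_def numeral_2_eq_2)

lemma less_three: "i < (3::nat) \<longleftrightarrow> i = 0 \<or> i = 1 \<or> i = 2"
  by auto

lemma linear_over_entry_differences:
  assumes "F = \<real> \<or> F = UNIV"
  shows "linear_over F 2 2 3 entry_differences"
proof -
  have "entry_differences Y \<in> vecs_over F 3" if "Y \<in> mats_over F 2 2" for Y
    using assms that
    by (auto simp: vecs_over_iff mats_over_iff all_less_two less_three intro: carrier_vecI)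
  moreover have "entry_differences (Y + Z) = entry_differences Y + entry_differences Z"
    if "Y \<in> mats_over F 2 2" "Z \<in> mats_over F 2 2" for Y Z
    using that by (intro eq_vecI) (auto simp: mats_over_def less_three)
  moreover have "entry_differences (c \<cdot>\<^sub>m Y) = c \<cdot>\<^sub>v entry_differences Y"
    if "Y \<in> mats_over F 2 2" for c Y
    using that by (intro eq_vecI) (auto simp: mats_over_def less_three algebra_simps)
  ultimately show ?thesis
    unfolding linear_over_def by blast
qed

lemma null_space_entry_differences:
  assumes Q: "Q = mat_of_rows_list 2 [[1, 1], [1, 1]]"
  shows "null_space F 2 2 3 entry_differences = {t \<cdot>\<^sub>m Q | t. t \<in> F}"
proof (intro equalityI subsetI)
  fix W assume "W \<in> null_space F 2 2 3 entry_differences"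
  then have W: "W \<in> mats_over F 2 2" and 0: "\<And>i. i < 3 \<Longrightarrow> entry_differences W $ i = 0"
    by (auto simp: null_space_def)
  have eq: "W $$ (0, 0) = W $$ (1, 1)" "W $$ (0, 1) = W $$ (1, 1)" "W $$ (1, 0) = W $$ (1, 1)"
    using 0[of 0] 0[of 1] 0[of 2] by simp_all
  have "W = W $$ (1, 1) \<cdot>\<^sub>m Q"
    using W eq unfolding Q
    by (intro eq_matI) (auto simp: mats_over_def mat_of_rows_list_def numeral_2_eq_2 less_Suc_eq)
  moreover have "W $$ (1, 1) \<in> F"
    using W by (simp add: mats_over_iff)
  ultimately show "W \<in> {t \<cdot>\<^sub>m Q | t. t \<in> F}"
    by blast
next
  fix W assume "W \<in> {t \<cdot>\<^sub>m Q | t. t \<in> F}"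
  then obtain t where t: "t \<in> F" "W = t \<cdot>\<^sub>m Q"
    by blast
  have "entry_differences W = 0\<^sub>v 3"
    unfolding t Q by (intro eq_vecI) (auto simp: mat_of_rows_list_def less_three)
  moreover have "W \<in> mats_over F 2 2"
    using t unfolding Q
    by (auto simp: mats_over_iff mat_of_rows_list_def all_less_two)
  ultimately show "W \<in> null_space F 2 2 3 entry_differences"
    by (simp add: null_space_def)
qed

section \<open>The counterexample\<close>

theorem mainTheorem2:
  fixes F :: "complex set" and X Q U V Ub Vb :: "complex mat"
  assumes "F = \<real> \<or> F = UNIV"
    and "X = mat_of_rows_list 2 [[-1, 0], [0, 0]]"
    and "Q = mat_of_rows_list 2 [[1, 1], [1, 1]]"
    and "U = mat_of_rows_list 1 [[1], [0]]"
    and "V = mat_of_rows_list 1 [[-1], [0]]"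
    and "Ub = mat_of_rows_list 1 [[0], [1]]"
    and "Vb = mat_of_rows_list 1 [[0], [1]]"
  shows
    "\<not> (\<forall>p q m r \<A> X' U' S' V' Ub' Vb'.
          linear_over F p q m \<A> \<and> compact_svd F p q r X' U' S' V' \<and>
          unitary_completion F p r U' Ub' \<and> unitary_completion F q r V' Vb' \<and>
          nnm_solutions F p q \<A> (\<A> X') = {X'} \<longrightarrow>
          null_space_condition (null_space F p q m \<A>) U' V' Ub' Vb')
     \<and> compact_svd F 2 2 1 X U (1\<^sub>m 1) V
     \<and> unitary_completion F 2 1 U Ub \<and> unitary_completion F 2 1 V Vb
     \<and> (\<forall>m \<A>. linear_over F 2 2 m \<A> \<and> null_space F 2 2 m \<A> = {t \<cdot>\<^sub>m Q | t. t \<in> F} \<longrightarrow>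
          - complex_of_real (cmod (mat_trace (mat_adjoint U * Q * V)))
              + complex_of_real (nuclear_norm (mat_adjoint Ub * Q * Vb))
            = mat_trace (mat_adjoint U * Q * V)
              + complex_of_real (nuclear_norm (mat_adjoint Ub * Q * Vb))
          \<and> mat_trace (mat_adjoint U * Q * V)
              + complex_of_real (nuclear_norm (mat_adjoint Ub * Q * Vb)) = 0
          \<and> Q \<in> null_space F 2 2 m \<A> \<and> Q \<noteq> 0\<^sub>m 2 2
          \<and> \<not> Re (mat_trace (mat_adjoint U * Q * V)) + nuclear_norm (mat_adjoint Ub * Q * Vb) > 0
          \<and> \<not> null_space_condition (null_space F 2 2 m \<A>) U V Ub Vb
          \<and> nuclear_norm X = 1
          \<and> (\<forall>t \<in> F. t \<noteq> 0 \<longrightarrow> nuclear_norm (X + t \<cdot>\<^sub>m Q) > 1)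
          \<and> nnm_solutions F 2 2 \<A> (\<A> X) = {X})"
proof -
  note F = assms(1)
  have F01: "0 \<in> F" "1 \<in> F" "-1 \<in> F"
    using F by auto
  note mats = assms(2-7)
  have cX: "X \<in> carrier_mat 2 2" and cQ: "Q \<in> carrier_mat 2 2" and cU: "U \<in> carrier_mat 2 1"
    and cV: "V \<in> carrier_mat 2 1" and cUb: "Ub \<in> carrier_mat 2 1" and cVb: "Vb \<in> carrier_mat 2 1"
    unfolding mats by (auto simp: mat_of_rows_list_def)
  note dims = cX[THEN carrier_matD(1)] cX[THEN carrier_matD(2)]
    cQ[THEN carrier_matD(1)] cQ[THEN carrier_matD(2)] cU[THEN carrier_matD(1)] cU[THEN carrier_matD(2)]
    cV[THEN carrier_matD(1)] cV[THEN carrier_matD(2)] cUb[THEN carrier_matD(1)] cUb[THEN carrier_matD(2)]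
    cVb[THEN carrier_matD(1)] cVb[THEN carrier_matD(2)]
  have eX: "X $$ (0, 0) = -1" "X $$ (0, 1) = 0" "X $$ (1, 0) = 0" "X $$ (1, 1) = 0"
    unfolding mats by (auto simp: mat_of_rows_list_def)
  have eQ: "Q $$ (0, 0) = 1" "Q $$ (0, 1) = 1" "Q $$ (1, 0) = 1" "Q $$ (1, 1) = 1"
    unfolding mats by (auto simp: mat_of_rows_list_def)
  have eU: "U $$ (0, 0) = 1" "U $$ (1, 0) = 0" and eV: "V $$ (0, 0) = -1" "V $$ (1, 0) = 0"
    and eUb: "Ub $$ (0, 0) = 0" "Ub $$ (1, 0) = 1" and eVb: "Vb $$ (0, 0) = 0" "Vb $$ (1, 0) = 1"
    unfolding mats by (auto simp: mat_of_rows_list_def)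
  \<comment> \<open>Simplification rewrites the index \<open>1\<close> to \<open>Suc 0\<close>, so the rules are kept in that form.\<close>
  note entries = eX[unfolded One_nat_def] eQ[unfolded One_nat_def]
    eU[unfolded One_nat_def] eV[unfolded One_nat_def] eUb[unfolded One_nat_def] eVb[unfolded One_nat_def]
  have mat2_eqI: "A = B" if "A \<in> carrier_mat 2 2" "B \<in> carrier_mat 2 2" "A $$ (0, 0) = B $$ (0, 0)"
    "A $$ (0, 1) = B $$ (0, 1)" "A $$ (1, 0) = B $$ (1, 0)" "A $$ (1, 1) = B $$ (1, 1)"
    for A B :: "complex mat"
    using that by (intro eq_matI) (auto simp: numeral_2_eq_2 less_Suc_eq)

  have X_F: "X \<in> mats_over F 2 2"
    using cX F01 entries by (simp add: mats_over_iff all_less_two)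
  have cols_F: "U \<in> mats_over F 2 1" "V \<in> mats_over F 2 1" "Ub \<in> mats_over F 2 1" "Vb \<in> mats_over F 2 1"
    using cU cV cUb cVb F01 entries by (simp_all add: mats_over_iff all_less_two)

  have "mat_adjoint U * U = 1\<^sub>m 1"
    by (rule eq_matI) (simp_all add: index_mult_2 dims entries del: index_mult_mat(1))
  moreover have "mat_adjoint V * V = 1\<^sub>m 1"
    by (rule eq_matI) (simp_all add: index_mult_2 dims entries del: index_mult_mat(1))
  moreover have "X = U * map_mat complex_of_real (1\<^sub>m 1) * mat_adjoint V"
  proof (rule mat2_eqI)
    show "X \<in> carrier_mat 2 2" by (rule cX)
    show "U * map_mat complex_of_real (1\<^sub>m 1) * mat_adjoint V \<in> carrier_mat 2 2"
      by (rule carrier_matI) (simp_all add: dims)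
  qed (simp_all add: index_mult_1 dims entries del: index_mult_mat(1))
  ultimately have svd: "compact_svd F 2 2 1 X U (1\<^sub>m 1) V"
    using X_F cols_F by (auto simp: compact_svd_def diagonal_mat_def)

  \<comment> \<open>Both joined matrices are \<open>diag(c, 1)\<close>, with \<open>c = 1\<close> for \<open>U\<close> and \<open>c = -1\<close> for \<open>V\<close>.\<close>
  have unitary: "unitary_mat 2 (join_cols A B)"
    if A: "A \<in> carrier_mat 2 1" "A $$ (0, 0) = c" "A $$ (1, 0) = 0"
      and B: "B \<in> carrier_mat 2 1" "B $$ (0, 0) = 0" "B $$ (1, 0) = 1"
      and c: "cnj c * c = 1" for A B c
  proof -
    let ?J = "join_cols A B"
    have cJ: "?J \<in> carrier_mat 2 2"
      using A B by (auto simp: join_cols_def)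
    have "?J $$ (0, 0) = c" "?J $$ (0, 1) = 0" "?J $$ (1, 0) = 0" "?J $$ (1, 1) = 1"
      using A B by (auto simp: join_cols_def mat_of_cols_index nth_append)
    note eJ = this[unfolded One_nat_def]
    have "mat_adjoint ?J * ?J = 1\<^sub>m 2" "?J * mat_adjoint ?J = 1\<^sub>m 2"
      using cJ c eJ by (auto intro!: mat2_eqI simp: index_mult_2 mult.commute simp del: index_mult_mat(1))
    then show ?thesis
      using cJ by (simp add: unitary_mat_def)
  qed
  have complU: "unitary_completion F 2 1 U Ub"
    using unitary[OF cU eU cUb eUb] cols_F by (simp add: unitary_completion_def)
  have complV: "unitary_completion F 2 1 V Vb"
    using unitary[OF cV eV cVb eVb] cols_F by (simp add: unitary_completion_def)

  have c11: "mat_adjoint U * Q * V \<in> carrier_mat 1 1" "mat_adjoint Ub * Q * Vb \<in> carrier_mat 1 1"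
    by (rule carrier_matI; simp add: dims)+
  have tr: "mat_trace (mat_adjoint U * Q * V) = -1"
    unfolding mat_trace_1[OF c11(1)] by (simp add: index_mult_2 dims entries del: index_mult_mat(1))
  have nn: "nuclear_norm (mat_adjoint Ub * Q * Vb) = 1"
    unfolding nuclear_norm_1[OF c11(2)] by (simp add: index_mult_2 dims entries del: index_mult_mat(1))
  have nnX: "nuclear_norm X = 1"
    using nuclear_norm_2[OF cX] by (simp add: entries)
  have perturb: "nuclear_norm (X + t \<cdot>\<^sub>m Q) > 1" if "t \<noteq> 0" for t
  proof (rule nuclear_norm_corner_perturbation)
    show "X + t \<cdot>\<^sub>m Q \<in> carrier_mat 2 2"
      by (rule carrier_matI) (simp_all add: dims)
  qed (use that in \<open>simp_all add: dims entries\<close>)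
  have Q0: "Q \<noteq> 0\<^sub>m 2 2"
    using eQ(1) by auto

  have main: "Q \<in> null_space F 2 2 m \<A> \<and> \<not> null_space_condition (null_space F 2 2 m \<A>) U V Ub Vb
      \<and> nnm_solutions F 2 2 \<A> (\<A> X) = {X}"
    if lin: "linear_over F 2 2 m \<A>" and ns: "null_space F 2 2 m \<A> = {t \<cdot>\<^sub>m Q | t. t \<in> F}" for m \<A>
  proof -
    have "1 \<cdot>\<^sub>m Q = Q"
      by (rule eq_matI) auto
    then have Q_ns: "Q \<in> null_space F 2 2 m \<A>"
      unfolding ns using F01 by force
    moreover have "\<not> null_space_condition (null_space F 2 2 m \<A>) U V Ub Vb"
      using Q_ns Q0 tr nn by (force simp: null_space_condition_def dims)
    moreover have "nnm_solutions F 2 2 \<A> (\<A> X) = {X}"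
    proof (rule nnm_solutions_singletonI[OF F lin X_F])
      fix W assume "W \<in> null_space F 2 2 m \<A>" and W0: "W \<noteq> 0\<^sub>m 2 2"
      then obtain t where W: "W = t \<cdot>\<^sub>m Q"
        unfolding ns by blast
      have "t \<noteq> 0"
      proof
        assume "t = 0"
        then have "W = 0\<^sub>m 2 2"
          unfolding W by (intro eq_matI) (auto simp: dims)
        with W0 show False ..
      qed
      then show "nuclear_norm X < nuclear_norm (X + W)"
        using perturb nnX W by simp
    qed
    ultimately show ?thesis
      by blast
  qed

  have lin: "linear_over F 2 2 3 entry_differences"
    using F by (rule linear_over_entry_differences)
  have ns: "null_space F 2 2 3 entry_differences = {t \<cdot>\<^sub>m Q | t. t \<in> F}"
    using assms(3) by (rule null_space_entry_differences)
  have main_all: "\<forall>m \<A>. linear_over F 2 2 m \<A> \<and> null_space F 2 2 m \<A> = {t \<cdot>\<^sub>m Q | t. t \<in> F} \<longrightarrow>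
      Q \<in> null_space F 2 2 m \<A> \<and> \<not> null_space_condition (null_space F 2 2 m \<A>) U V Ub Vb
      \<and> nnm_solutions F 2 2 \<A> (\<A> X) = {X}"
    using main by blast
  show ?thesis
  proof (intro conjI)
    show "\<not> (\<forall>p q m r \<A> X' U' S' V' Ub' Vb'.
          linear_over F p q m \<A> \<and> compact_svd F p q r X' U' S' V' \<and>
          unitary_completion F p r U' Ub' \<and> unitary_completion F q r V' Vb' \<and>
          nnm_solutions F p q \<A> (\<A> X') = {X'} \<longrightarrow>
          null_space_condition (null_space F p q m \<A>) U' V' Ub' Vb')"
    proof
      assume all: "\<forall>p q m r \<A> X' U' S' V' Ub' Vb'.
          linear_over F p q m \<A> \<and> compact_svd F p q r X' U' S' V' \<and>
          unitary_completion F p r U' Ub' \<and> unitary_completion F q r V' Vb' \<and>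
          nnm_solutions F p q \<A> (\<A> X') = {X'} \<longrightarrow>
          null_space_condition (null_space F p q m \<A>) U' V' Ub' Vb'"
      have "null_space_condition (null_space F 2 2 3 entry_differences) U V Ub Vb"
        by (rule all[rule_format])
          (rule conjI lin svd complU complV main[OF lin ns, THEN conjunct2, THEN conjunct2])+
      then show False
        using main[OF lin ns] by blast
    qed
  qed (use svd complU complV main_all tr nn nnX perturb Q0 in \<open>simp_all\<close>)
qed

end
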